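(* Let $P$ be a triangular patch on a smooth oriented surface in $\mathbb{R}^3$, let $\boldsymbol r'\in\mathbb{R}^3\setminus P$, and let $1\le m\le l$ be integers. Let $\tilde\chi^{(l,m)}$ be the complex 2-form (in $\boldsymbol r$) $$\tilde\chi^{(l,m)}(\boldsymbol r',\boldsymbol r)=\left(G(\boldsymbol r',\boldsymbol r)\nabla S^{(l,m)}(\boldsymbol r)-\nabla G(\boldsymbol r',\boldsymbol r)\,S^{(l,m)}(\boldsymbol r)\right)\cdot\boldsymbol\nu(\boldsymbol r)\,da(\boldsymbol r).$$ Define the complex 1-form $$\tilde\psi^{(l,m)}(\boldsymbol r',\boldsymbol r)=\frac{1}{4\pi}\sum_{j=1}^l D_{j,l}\sum_{k=-j}^j v^{(j,k)}(\boldsymbol r',\boldsymbol r)\,S^{(l-j,m-k)}(\boldsymbol r')\,T_{jk,lm},$$ where $$D_{j,l}=\int_0^1t^{j-1}(1-t)^{l-j}\,dt=\frac{(j-1)!\,(l-j)!}{l!},\qquad v^{(j,k)}(\boldsymbol r',\boldsymbol r)=\frac{1}{|\boldsymbol r'-\boldsymbol r|}\left[(\boldsymbol r'-\boldsymbol r)\times\nabla S^{(j,k)}(\boldsymbol r)\right]\cdot d\boldsymbol r.$$ Let $$\omega_0(\boldsymbol r',\boldsymbol r)=-\frac{((\boldsymbol r'-\boldsymbol r)\times\boldsymbol u)\cdot d\boldsymbol r}{|\boldsymbol r'-\boldsymbol r|\left(|\boldsymbol r'-\boldsymbol r|+\boldsymbol u\cdot(\boldsymbol r'-\boldsymbol r)\right)},$$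 with $\boldsymbol u$ a fixed unit vector such that $(\boldsymbol r'-\boldsymbol r)\cdot\boldsymbol u\ge0$ for every $\boldsymbol r\in P$. Then, as differential forms in $\boldsymbol r$ in a neighborhood of $P$, $$d\left(\tilde\psi^{(l,m)}(\boldsymbol r',\boldsymbol r)+\frac{1}{4\pi}S^{(l,m)}(\boldsymbol r')\,\omega_0(\boldsymbol r',\boldsymbol r)\right)=\tilde\chi^{(l,m)}(\boldsymbol r',\boldsymbol r).$$
   Context: Kernel: $G(\boldsymbol r',\boldsymbol r)=\dfrac{1}{4\pi|\boldsymbol r'-\boldsymbol r|}$. The point $\boldsymbol r'$ is fixed; $\nabla$ and the exterior derivative $d$ are with respect to $\boldsymbol r=(x,y,z)$. Area form: $\boldsymbol\nu(\boldsymbol r)\,da(\boldsymbol r)$ denotes the vector-valued 2-form $(dy\wedge dz,\ dz\wedge dx,\ dx\wedge dy)$, which restricts on an oriented surface to unit normal times area element; thus $\boldsymbol f\cdot\boldsymbol\nu\,da=f_1\,dy\wedge dz+f_2\,dz\wedge dx+f_3\,dx\wedge dy$. $d\boldsymbol r=(dx,dy,dz)$. The operations $\cdot$ and $\times$ are extended complex-bilinearly. Solid harmonics: for $l\ge0$, $-l\le m\le l$, let $P_l^m(x)=\frac{1}{2^l l!}(1-x^2)^{m/2}\frac{d^{l+m}}{dx^{l+m}}(x^2-1)^l$, $$R_l^m(\boldsymbol r)=\sqrt{\frac{(l-m)!}{(l+m)!}}\;r^l P_l^m(\cos\theta)e^{im\phi},$$ where $(r,\theta,\phi)$ are the spherical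 coordinates of $\boldsymbol r$ ($\theta$ the polar angle from the $z$-axis); $R_l^m$ is a homogeneous harmonic polynomial of degree $l$ in $(x,y,z)$. Set $S^{(l,m)}(x,y,z)=R_l^m(y,z,x)$, and $$T_{jk,lm}=\binom{l+m}{j+k}^{1/2}\binom{l-m}{j-k}^{1/2},$$ where binomial coefficients outside the usual range are zero (so terms with $|m-k|>l-j$ vanish). *)

theory Defs
  imports "HOL-Analysis.Analysis"
begin

unbundle cross3_syntax

primrec Ck_on :: "nat \<Rightarrow> ('a::real_normed_vector \<Rightarrow> 'b::real_normed_vector) \<Rightarrow> 'a set \<Rightarrow> bool" where
  "Ck_on 0 f W \<longleftrightarrow> continuous_on W f"
| "Ck_on (Suc k) f W \<longleftrightarrow> (\<forall>x\<in>W. f differentiable (at x)) \<and>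
     (\<forall>v. Ck_on k (\<lambda>x. frechet_derivative f (at x) v) W)"

text \<open>Only used for open \<open>W\<close>.\<close>
definition smooth_on :: "('a::real_normed_vector \<Rightarrow> 'b::real_normed_vector) \<Rightarrow> 'a set \<Rightarrow> bool" where
  "smooth_on f W \<longleftrightarrow> (\<forall>k. Ck_on k f W)"

text \<open>A surface is a set \<open>M\<close> together with a unit normal field \<open>n\<close>, which is its orientation. The
  last conjunct says at once that the chart \<open>\<rho>\<close> is an immersion, that \<open>n\<close> is normal to \<open>M\<close>, and that
  \<open>\<rho>\<close> is compatible with the orientation.\<close>
definition positive_chart ::
    "(real^3) set \<Rightarrow> (real^3 \<Rightarrow> real^3) \<Rightarrow> (real^2) set \<Rightarrow> (real^2 \<Rightarrow> real^3) \<Rightarrow> bool" where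
  "positive_chart M n W \<rho> \<longleftrightarrow>
     open W \<and> smooth_on \<rho> W \<and> (\<exists>\<tau>. homeomorphism W (\<rho> ` W) \<rho> \<tau>) \<and>
     openin (top_of_set M) (\<rho> ` W) \<and>
     (\<forall>w\<in>W. \<exists>c>0. frechet_derivative \<rho> (at w) (axis 1 1) \<times> frechet_derivative \<rho> (at w) (axis 2 1)
        = c *\<^sub>R n (\<rho> w))"

definition smooth_oriented_surface :: "(real^3) set \<Rightarrow> (real^3 \<Rightarrow> real^3) \<Rightarrow> bool" where
  "smooth_oriented_surface M n \<longleftrightarrow>
     continuous_on M n \<and> (\<forall>p\<in>M. norm (n p) = 1) \<and>
     (\<forall>p\<in>M. \<exists>W \<rho>. positive_chart M n W \<rho> \<and> p \<in> \<rho> ` W)"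

definition triangular_patch :: "(real^3) set \<Rightarrow> (real^3 \<Rightarrow> real^3) \<Rightarrow> (real^3) set \<Rightarrow> bool" where
  "triangular_patch M n P \<longleftrightarrow>
     (\<exists>W \<rho>. positive_chart M n W \<rho> \<and> convex hull {0, axis 1 1, axis 2 1} \<subseteq> W \<and>
        P = \<rho> ` (convex hull {0, axis 1 1, axis 2 1}))"

definition cvec :: "real^'n \<Rightarrow> complex^'n" where
  "cvec v = (\<chi> i. complex_of_real (v $ i))"

text \<open>The products below are bilinear, not sesquilinear.\<close>
definition cdot :: "complex^'n \<Rightarrow> complex^'n \<Rightarrow> complex" where
  "cdot f g = (\<Sum>i\<in>UNIV. f $ i * g $ i)"

definition ccross :: "complex^3 \<Rightarrow> complex^3 \<Rightarrow> complex^3" where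
  "ccross f g = vector [f$2 * g$3 - f$3 * g$2, f$3 * g$1 - f$1 * g$3, f$1 * g$2 - f$2 * g$1]"

lemma cdot_cvec: "cdot (cvec a) (cvec b) = complex_of_real (a \<bullet> b)"
  by (simp add: cdot_def cvec_def inner_vec_def)

lemma ccross_cvec: "ccross (cvec a) (cvec b) = cvec (a \<times> b)"
  by (simp add: ccross_def cvec_def cross3_def vec_eq_iff forall_3)

definition cgrad :: "(real^'n \<Rightarrow> complex) \<Rightarrow> real^'n \<Rightarrow> complex^'n" where
  "cgrad f r = (\<chi> i. frechet_derivative f (at r) (axis i 1))"

text \<open>A complex 1-form is represented by its values \<open>\<omega> r a\<close> at the point \<open>r\<close> on the tangent vector
  \<open>a\<close>, and a complex 2-form by its values \<open>\<eta> r a b\<close> on pairs of tangent vectors.\<close>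
type_synonym form1 = "real^3 \<Rightarrow> real^3 \<Rightarrow> complex"
type_synonym form2 = "real^3 \<Rightarrow> real^3 \<Rightarrow> real^3 \<Rightarrow> complex"

definition differentiable_form1_on :: "form1 \<Rightarrow> (real^3) set \<Rightarrow> bool" where
  "differentiable_form1_on \<omega> N \<longleftrightarrow>
     (\<forall>r\<in>N. linear (\<omega> r) \<and> (\<forall>a. (\<lambda>s. \<omega> s a) differentiable (at r)))"

text \<open>The exterior derivative, evaluated on constant vector fields. It is normalised such that
  \<open>d (f dx) = df \<and> dx\<close> for the wedge product below.\<close>
definition ext_d :: "form1 \<Rightarrow> form2" where
  "ext_d \<omega> r a b =
     frechet_derivative (\<lambda>s. \<omega> s b) (at r) a - frechet_derivative (\<lambda>s. \<omega> s a) (at r) b"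

definition wedge :: "(real^3 \<Rightarrow> complex) \<Rightarrow> (real^3 \<Rightarrow> complex) \<Rightarrow> real^3 \<Rightarrow> real^3 \<Rightarrow> complex" where
  "wedge \<alpha> \<beta> a b = \<alpha> a * \<beta> b - \<alpha> b * \<beta> a"

definition dcoord :: "3 \<Rightarrow> real^3 \<Rightarrow> complex" where
  "dcoord i a = complex_of_real (a $ i)"

definition dr :: "real^3 \<Rightarrow> complex^3" where
  "dr a = vector [dcoord 1 a, dcoord 2 a, dcoord 3 a]"

definition nu_da :: "real^3 \<Rightarrow> real^3 \<Rightarrow> complex^3" where
  "nu_da a b =
     vector [wedge (dcoord 2) (dcoord 3) a b, wedge (dcoord 3) (dcoord 1) a b,
             wedge (dcoord 1) (dcoord 2) a b]"

text \<open>The power \<open>(1 - x\<^sup>2)\<^bsup>m/2\<^esup>\<close> is written with \<open>powi\<close> because \<open>0 powr 0 = 0\<close>. For \<open>m < 0\<close> the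
  formula is singular at \<open>x = 1\<close> and \<open>x = -1\<close>, where its continuous extension is \<open>0\<close>; that is also
  its value here, as \<open>0 powi m = 0\<close>.\<close>
definition assoc_legendre :: "nat \<Rightarrow> int \<Rightarrow> real \<Rightarrow> real" where
  "assoc_legendre l m x =
     1 / (2 ^ l * fact l) * (sqrt (1 - x\<^sup>2) powi m) *
     (deriv ^^ nat (int l + m)) (\<lambda>t. (t\<^sup>2 - 1) ^ l) x"

definition polar_angle :: "real^3 \<Rightarrow> real" where
  "polar_angle v = arccos (v$3 / norm v)"

definition azimuth :: "real^3 \<Rightarrow> real" where
  "azimuth v = Arg (Complex (v$1) (v$2))"

text \<open>Where the angles are not determined (on the \<open>z\<close>-axis), their choice does not affect the value.
  Meant for \<open>\<bar>m\<bar> \<le> l\<close>.\<close>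
definition solid_R :: "nat \<Rightarrow> int \<Rightarrow> real^3 \<Rightarrow> complex" where
  "solid_R l m v =
     complex_of_real (sqrt (fact (nat (int l - m)) / fact (nat (int l + m))) *
       norm v ^ l * assoc_legendre l m (cos (polar_angle v))) *
     exp (\<i> * of_int m * complex_of_real (azimuth v))"

definition solid_S :: "nat \<Rightarrow> int \<Rightarrow> real^3 \<Rightarrow> complex" where
  "solid_S l m v = solid_R l m (vector [v$2, v$3, v$1])"

definition int_choose :: "int \<Rightarrow> int \<Rightarrow> nat" where
  "int_choose n k = (if 0 \<le> k \<and> k \<le> n then nat n choose nat k else 0)"

definition T_coef :: "nat \<Rightarrow> int \<Rightarrow> nat \<Rightarrow> int \<Rightarrow> real" where
  "T_coef j k l m =
     sqrt (real (int_choose (int l + m) (int j + k))) *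
     sqrt (real (int_choose (int l - m) (int j - k)))"

definition D_coef :: "nat \<Rightarrow> nat \<Rightarrow> real" where
  "D_coef j l = integral {0..1} (\<lambda>t. t ^ (j - 1) * (1 - t) ^ (l - j))"

lemma D_coef_eq:
  assumes "1 \<le> j" "j \<le> l"
  shows "D_coef j l = fact (j - 1) * fact (l - j) / fact l"
proof -
  have "((\<lambda>t. t powr (real j - 1) * (1 - t) powr (real (l - j) + 1 - 1)) has_integral
          Beta (real j) (real (l - j) + 1)) {0..1}"
    using assms by (intro has_integral_Beta_real) auto
  moreover have "Beta (real j) (real (l - j) + 1) = fact (j - 1) * fact (l - j) / fact l"
  proof -
    have "Gamma (real j) = fact (j - 1)"
      using assms Gamma_fact[of "j - 1", where 'a = real] by (simp add: of_nat_diff)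
    moreover have "Gamma (real (l - j) + 1) = fact (l - j)"
      using Gamma_fact[of "l - j", where 'a = real] by (simp add: add.commute)
    moreover have "Gamma (real j + (real (l - j) + 1)) = fact l"
      using assms Gamma_fact[of l, where 'a = real] by (simp add: of_nat_diff add.commute)
    ultimately show ?thesis by (simp add: Beta_def)
  qed
  ultimately have "((\<lambda>t. t powr (real j - 1) * (1 - t) powr (real (l - j) + 1 - 1)) has_integral
      fact (j - 1) * fact (l - j) / fact l) {0..1}" by simp
  hence "((\<lambda>t. t ^ (j - 1) * (1 - t) ^ (l - j)) has_integral
      fact (j - 1) * fact (l - j) / fact l) {0..1::real}"
  proof (rule has_integral_spike_finite[where S = "{0,1}", rotated 2])
    fix t :: real assume "t \<in> {0..1} - {0,1}"
    hence "t > 0" "1 - t > 0" by auto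
    thus "t ^ (j - 1) * (1 - t) ^ (l - j) =
        t powr (real j - 1) * (1 - t) powr (real (l - j) + 1 - 1)"
      using assms by (simp add: powr_realpow[symmetric] of_nat_diff)
  qed auto
  thus ?thesis unfolding D_coef_def by (rule integral_unique)
qed

definition green :: "real^3 \<Rightarrow> real^3 \<Rightarrow> real" where
  "green r' r = 1 / (4 * pi * norm (r' - r))"

definition chi_form :: "nat \<Rightarrow> int \<Rightarrow> real^3 \<Rightarrow> form2" where
  "chi_form l m r' r a b =
     cdot (complex_of_real (green r' r) *s cgrad (solid_S l m) r
           - solid_S l m r *s cgrad (\<lambda>s. complex_of_real (green r' s)) r)
          (nu_da a b)"

definition v_form :: "nat \<Rightarrow> int \<Rightarrow> real^3 \<Rightarrow> form1" where
  "v_form j k r' r a =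
     complex_of_real (1 / norm (r' - r)) *
     cdot (ccross (cvec (r' - r)) (cgrad (solid_S j k) r)) (dr a)"

text \<open>If \<open>\<bar>m - k\<bar> > l - j\<close>, then \<open>T_coef j k l m = 0\<close>, and the value of \<open>solid_S (l - j) (m - k)\<close> does
  not matter.\<close>
definition psi_form :: "nat \<Rightarrow> int \<Rightarrow> real^3 \<Rightarrow> form1" where
  "psi_form l m r' r a =
     complex_of_real (1 / (4 * pi)) *
     (\<Sum>j = 1..l. complex_of_real (D_coef j l) *
        (\<Sum>k = - int j..int j.
           v_form j k r' r a * solid_S (l - j) (m - k) r' * complex_of_real (T_coef j k l m)))"

definition omega0 :: "real^3 \<Rightarrow> real^3 \<Rightarrow> form1" where
  "omega0 u r' r a =
     - cdot (ccross (cvec (r' - r)) (cvec u)) (dr a) /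
       complex_of_real (norm (r' - r) * (norm (r' - r) + u \<bullet> (r' - r)))"

end

theory Submission
  imports Defs
begin

text \<open>
  The polynomial \<open>L v s = (v\<^sub>2 + i v\<^sub>3) s\<^sup>2 + 2 v\<^sub>1 s - (v\<^sub>2 - i v\<^sub>3)\<close> in \<open>s\<close> is linear in \<open>v\<close>, and up to a
  constant \<open>S\<^bsup>(l,m)\<^esup>(v)\<close> is the coefficient of \<open>s\<^bsup>l+m\<^esup>\<close> in \<open>(L v)\<^bsup>l\<^esup>\<close>. Harmonicity amounts to the fact that
  the vector of coefficients of \<open>v\<close> in \<open>L v s\<close> is null, and the addition theorem that produces \<open>T\<^bsub>jk,lm\<^esub>\<close> to
  the multiplication of polynomials. As \<open>j D\<^bsub>j,l\<^esub>\<close> is the inverse of a binomial coefficient,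
  \<open>\<psi> = (1 / 4\<pi>) |r' - r|\<^bsup>-1\<^esup> [(r' - r) \<times> H] \<cdot> dr\<close>, where \<open>H\<close> is the gradient in \<open>r\<close> given by the coefficient
  of \<open>s\<^bsup>l+m\<^esup>\<close> in \<open>L a \<Sum>\<^sub>j (L r)\<^bsup>j-1\<^esup> (L r')\<^bsup>l-j\<^esup>\<close>, \<open>a\<close> being the direction. The sum telescopes against \<open>L (r - r')\<close>,
  which gives \<open>H \<cdot> (r - r') = S r - S r'\<close> and \<open>H + ((r - r') \<cdot> \<nabla>) H = \<nabla>S\<close>; moreover \<open>div H = 0\<close>.
  Taking the curl yields \<open>\<chi>\<close> up to \<open>S r'\<close> times the solid angle form, which is \<open>d \<omega>\<^sub>0\<close>.
\<close>

subsection \<open>Solid harmonics as coefficients of powers of a null polynomial\<close>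

lemma higher_deriv_poly: "(deriv ^^ n) (poly p) = poly ((pderiv ^^ n) (p :: real poly))"
proof (induction n)
  case (Suc n)
  have "deriv (poly ((pderiv ^^ n) p)) = poly (pderiv ((pderiv ^^ n) p))"
    by (intro ext DERIV_imp_deriv poly_DERIV)
  with Suc show ?case by simp
qed simp

lemma higher_pderiv_pcompose_shift:
  "(pderiv ^^ n) (pcompose p [:x, 1:]) = pcompose ((pderiv ^^ n) p) [:x, 1:]"
  by (induction n) (simp_all add: pderiv_pcompose pderiv_pCons)

text \<open>Taylor's formula: composing with \<open>[:x, 1:]\<close> moves the point
  \<open>x\<close> to 0, where the derivatives are factorials times coefficients.\<close>

lemma poly_higher_pderiv:
  fixes p :: "real poly"
  shows "poly ((pderiv ^^ n) p) x = fact n * coeff (pcompose p [:x, 1:]) n"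
proof -
  have "poly ((pderiv ^^ n) p) x = coeff (pcompose ((pderiv ^^ n) p) [:x, 1:]) 0"
    by (simp add: poly_0_coeff_0[symmetric] poly_pcompose)
  also have "\<dots> = coeff ((pderiv ^^ n) (pcompose p [:x, 1:])) 0"
    by (simp add: higher_pderiv_pcompose_shift)
  also have "\<dots> = fact n * coeff (pcompose p [:x, 1:]) n"
    by (simp add: coeff_higher_pderiv pochhammer_fact)
  finally show ?thesis .
qed

lemma pcompose_power: "pcompose (p ^ n) q = pcompose p q ^ (n::nat)" for p :: "'a::comm_semiring_1 poly"
  by (induction n) (simp_all add: pcompose_mult pcompose_1)

text \<open>Shifting t^2 - 1 by \<open>x\<close> gives the trinomial, and the derivative of order l
  + m in Rodrigues' formula becomes a Taylor coefficient. This form is purely algebraic.\<close>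

lemma assoc_legendre_eq:
  "assoc_legendre l m x = fact (nat (int l + m)) / (2 ^ l * fact l) * (sqrt (1 - x\<^sup>2) powi m) *
     coeff ([:x\<^sup>2 - 1, 2 * x, 1:] ^ l) (nat (int l + m))"
proof -
  have 1: "(\<lambda>t. (t\<^sup>2 - 1) ^ l) = poly ([:-1, 0, 1:] ^ l :: real poly)"
    by (auto simp: fun_eq_iff power2_eq_square)
  have 2: "pcompose [:-1, 0, 1:] [:x, 1:] = [:x\<^sup>2 - 1, 2 * x, 1:]"
    by (simp add: pcompose_pCons power2_eq_square)
  show ?thesis
    unfolding assoc_legendre_def 1 higher_deriv_poly poly_higher_pderiv pcompose_power 2
    by simp
qed

lemma coeff_of_real_poly_power:
  "coeff ([:of_real a, of_real b, of_real c:] ^ l) n = complex_of_real (coeff ([:a, b, c:] ^ l) n)"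
  by (induction l arbitrary: n) (simp_all add: coeff_mult coeff_pCons split: nat.splits)

text \<open>Its discriminant is \<open>4 |v|\<^sup>2\<close>. In spherical coordinates it is \<open>|v| (\<sigma> s\<^sup>2 + 2 x s - cnj \<sigma>)\<close> with
  \<open>x = cos \<theta>\<close> and \<open>\<sigma> = sin \<theta> e\<^bsup>i\<phi>\<^esup>\<close>, and the substitution \<open>h = \<sigma> s\<close> turns \<open>\<sigma>\<close> times the bracket into
  \<open>(x + h)\<^sup>2 - 1\<close>, so that Rodrigues' formula reads off the Taylor coefficients of its powers.\<close>
definition null_poly :: "real^3 \<Rightarrow> complex poly" where
  "null_poly v = [:- Complex (v$2) (- v$3), 2 * complex_of_real (v$1), Complex (v$2) (v$3):]"

text \<open>Collects 2^l l! from Rodrigues' formula, the (l+m)! of the Taylor coefficient and the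
  root of (l-m)! / (l+m)! in the solid harmonic.\<close>

definition harm_norm :: "nat \<Rightarrow> int \<Rightarrow> real" where
  "harm_norm l m = 2 ^ l * fact l / sqrt (fact (nat (int l + m)) * fact (nat (int l - m)))"

lemma harm_norm_pos: "harm_norm l m > 0"
  by (simp add: harm_norm_def)

lemma coeff_trinomial_power:
  fixes \<sigma> :: complex and x :: real
  assumes "cmod \<sigma> ^ 2 + x\<^sup>2 = 1" and m: "\<bar>m\<bar> \<le> int l"
  shows "coeff ([:- cnj \<sigma>, 2 * of_real x, \<sigma>:] ^ l) (nat (int l + m)) =
    \<sigma> powi m * of_real (coeff ([:x\<^sup>2 - 1, 2 * x, 1:] ^ l) (nat (int l + m)))"
proof (cases "\<sigma> = 0")
  \<comment> \<open>At the poles the substitution h = \<sigma> s degenerates, so both sides are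
    computed. On the left only the power s^l survives; on the right \<open>0 powi m\<close> is 0 for
    all m \<noteq> 0, negative ones included.\<close>
  case True
  then have x: "x\<^sup>2 = 1" using assms by simp
  have *: "[:0, 2 * complex_of_real x:] ^ l = monom ((2 * of_real x) ^ l) l"
  proof -
    have "[:0, 2 * complex_of_real x:] = monom (2 * of_real x) 1" by (simp add: monom_Suc monom_0)
    then show ?thesis by (simp only: monom_power) simp
  qed
  show ?thesis
  proof (cases "m = 0")
    case False
    then show ?thesis using True m by (auto simp: * power_int_0_left)
  next
    case True2: True
    have "[:x\<^sup>2 - 1, 2 * x, 1:] ^ l = [:2 * x, 1:] ^ l * monom 1 l"
    proof -
      have "[:x\<^sup>2 - 1, 2 * x, 1:] = [:2 * x, 1:] * monom 1 1"
        using x by (simp add: monom_Suc monom_0)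
      then show ?thesis by (simp only: power_mult_distrib monom_power) simp
    qed
    then have "coeff ([:x\<^sup>2 - 1, 2 * x, 1:] ^ l) l = (2 * x) ^ l"
      by (simp add: mult.commute[of _ "monom _ _"] coeff_monom_mult poly_0_coeff_0[symmetric] poly_power)
    then show ?thesis using True True2 by (simp add: *)
  qed
next
  case False
  have sc: "\<sigma> * cnj \<sigma> = 1 - of_real (x\<^sup>2)"
    using assms(1) by (metis add_diff_cancel_right' complex_norm_square of_real_1 of_real_diff)
  let ?n = "nat (int l + m)"
  let ?q = "[:of_real (x\<^sup>2 - 1), of_real (2 * x), of_real 1:] :: complex poly"
  have "smult \<sigma> [:- cnj \<sigma>, 2 * of_real x, \<sigma>:] = pcompose ?q [:0, \<sigma>:]"
    by (simp add: pcompose_pCons sc power2_eq_square algebra_simps)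
  then have "smult (\<sigma> ^ l) ([:- cnj \<sigma>, 2 * of_real x, \<sigma>:] ^ l) = pcompose (?q ^ l) [:0, \<sigma>:]"
    by (simp only: pcompose_power flip: smult_power)
  from arg_cong[OF this, of "\<lambda>p. coeff p ?n"]
  have "\<sigma> ^ l * coeff ([:- cnj \<sigma>, 2 * of_real x, \<sigma>:] ^ l) ?n = \<sigma> ^ ?n * of_real (coeff ([:x\<^sup>2 - 1, 2 * x, 1:] ^ l) ?n)"
    by (simp only: coeff_smult coeff_pcompose_linear coeff_of_real_poly_power)
  also have "\<sigma> ^ ?n = \<sigma> ^ l * \<sigma> powi m"
    using False m by (simp flip: power_int_of_nat power_int_add)
  finally show ?thesis using False by simp
qed

text \<open>In spherical coordinates about the first axis, \<open>null_poly v\<close> is |v| times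
  the trinomial of \<open>coeff_trinomial_power\<close>; homogeneity extracts |v|^l, and the
  constants combine to \<open>harm_norm\<close>.\<close>

lemma solid_S_eq:
  assumes "\<bar>m\<bar> \<le> int l"
  shows "solid_S l m v = coeff (null_poly v ^ l) (nat (int l + m)) / of_real (harm_norm l m)"
proof -
  define w :: "real^3" where "w = vector [v$2, v$3, v$1]"
  define r where "r = norm w"
  define x where "x = cos (polar_angle w)"
  define E where "E = exp (\<i> * complex_of_real (azimuth w))"
  define \<sigma> where "\<sigma> = of_real (sqrt (1 - x\<^sup>2)) * E"
  have nE: "cmod E = 1" by (simp add: E_def norm_exp_i_times)
  have w_simps: "w$1 = v$2" "w$2 = v$3" "w$3 = v$1" by (simp_all add: w_def)
  have r2: "r\<^sup>2 = (v$2)\<^sup>2 + (v$3)\<^sup>2 + (v$1)\<^sup>2"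
    by (simp add: r_def power2_norm_eq_inner inner_vec_def sum_3 w_simps flip: power2_eq_square)
  have r0: "r \<ge> 0" by (simp add: r_def)
  have x1: "x\<^sup>2 \<le> 1" by (simp add: x_def abs_square_le_1)
  have rx: "r * x = v$1"
  \<comment> \<open>At the origin the polar angle is a default value, but it is multiplied by r =
    0.\<close>
  proof (cases "r = 0")
    case True
    then have "w = 0" by (simp add: r_def)
    then show ?thesis using True w_simps by simp
  next
    case False
    have "\<bar>w$3 / norm w\<bar> \<le> 1" using component_le_norm_cart[of w 3] by (simp add: divide_le_eq_1)
    then have "x = w$3 / norm w" by (simp add: x_def polar_angle_def cos_arccos_abs)
    then show ?thesis using False by (simp add: r_def w_simps)
  qed
  have "complex_of_real (r * sqrt (1 - x\<^sup>2)) = of_real (cmod (Complex (v$2) (v$3)))"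
  proof -
    have "r * sqrt (1 - x\<^sup>2) = sqrt (r\<^sup>2 - (r * x)\<^sup>2)"
    proof -
      have "r\<^sup>2 - (r * x)\<^sup>2 = r\<^sup>2 * (1 - x\<^sup>2)" by (simp add: power_mult_distrib algebra_simps)
      then show ?thesis using r0 by (simp only: real_sqrt_mult real_sqrt_abs abs_of_nonneg)
    qed
    then show ?thesis unfolding rx r2 by (simp add: cmod_def)
  qed
  \<comment> \<open>On the polar axis the argument is a default value; this does no harm to the
    polar decomposition below, as the modulus is 0 there.\<close>
  moreover have "E = cis (Arg (Complex (v$2) (v$3)))"
    by (simp add: E_def azimuth_def w_simps cis_conv_exp)
  ultimately have rs: "of_real r * \<sigma> = Complex (v$2) (v$3)"
    unfolding \<sigma>_def by (metis mult.assoc of_real_mult rcis_cmod_Arg rcis_def)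
  have "null_poly v = smult (of_real r) [:- cnj \<sigma>, 2 * of_real x, \<sigma>:]"
  proof -
    have "of_real r * cnj \<sigma> = cnj (Complex (v$2) (v$3))" by (metis rs complex_cnj_mult complex_cnj_complex_of_real)
    moreover have "of_real r * of_real x = complex_of_real (v$1)" by (metis rx of_real_mult)
    ultimately show ?thesis using rs by (auto simp: null_poly_def complex_cnj)
  qed
  then have "coeff (null_poly v ^ l) (nat (int l + m)) = of_real r ^ l * coeff ([:- cnj \<sigma>, 2 * of_real x, \<sigma>:] ^ l) (nat (int l + m))"
    by (simp only: coeff_smult smult_power)
  also have "\<dots> = of_real r ^ l * (\<sigma> powi m * of_real (coeff ([:x\<^sup>2 - 1, 2 * x, 1:] ^ l) (nat (int l + m))))"
    using assms x1 by (subst coeff_trinomial_power) (auto simp: \<sigma>_def norm_mult nE)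
  also have "\<sigma> powi m = of_real (sqrt (1 - x\<^sup>2) powi m) * exp (\<i> * of_int m * complex_of_real (azimuth w))"
  proof -
    have "E powi m = exp (\<i> * of_int m * complex_of_real (azimuth w))"
      unfolding E_def by (simp add: exp_power_int algebra_simps)
    then show ?thesis by (simp add: \<sigma>_def power_int_mult_distrib)
  qed
  finally have c: "coeff (null_poly v ^ l) (nat (int l + m)) = of_real (r ^ l * sqrt (1 - x\<^sup>2) powi m * coeff ([:x\<^sup>2 - 1, 2 * x, 1:] ^ l) (nat (int l + m)))
     * exp (\<i> * of_int m * complex_of_real (azimuth w))" by simp
  define A B :: real where "A = fact (nat (int l + m))" and "B = fact (nat (int l - m))"
  have "sqrt (B / A) * A = sqrt (A * B)"
    by (simp add: A_def real_sqrt_divide real_sqrt_mult field_simps)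
  then have k: "sqrt (B / A) * (A / (2 ^ l * fact l)) = 1 / harm_norm l m"
    by (simp add: harm_norm_def A_def B_def)
  have e: "sqrt (B / A) * r ^ l * assoc_legendre l m x = r ^ l * sqrt (1 - x\<^sup>2) powi m * coeff ([:x\<^sup>2 - 1, 2 * x, 1:] ^ l) (nat (int l + m)) * (1 / harm_norm l m)"
    unfolding assoc_legendre_eq A_def[symmetric] k[symmetric] by simp
  show ?thesis
    unfolding solid_S_def solid_R_def w_def[symmetric] r_def[symmetric] x_def[symmetric] A_def[symmetric] B_def[symmetric] c e
    by simp
qed

section \<open>The addition theorem\<close>

lemma degree_null_poly_power: "degree (null_poly v ^ n) \<le> 2 * n"
  using degree_power_le[of "null_poly v" n] by (simp add: null_poly_def degree_pCons_eq_if split: if_splits)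

text \<open>The powers of 2 cancel, the binomial absorbs the factorials of l, j and l - j, and the
  factorials under the roots are those of the two binomials in T. So T is what converts between
  normalised harmonics and bare coefficients.\<close>

lemma T_coef_eq:
  assumes "\<bar>m\<bar> \<le> int l" "j \<le> l" "\<bar>k\<bar> \<le> int j" "\<bar>m - k\<bar> \<le> int (l - j)"
  shows "T_coef j k l m = real (l choose j) * harm_norm j k * harm_norm (l - j) (m - k) / harm_norm l m"
proof -
  have s: "nat (int l + m) - nat (int j + k) = nat (int (l - j) + (m - k))"
    "nat (int l - m) - nat (int j - k) = nat (int (l - j) - (m - k))" 
    using assms by (auto simp: nat_diff_distrib' of_nat_diff)
  have 1: "T_coef j k l m = sqrt (fact (nat (int l + m)) / (fact (nat (int j + k)) * fact (nat (int (l - j) + (m - k)))))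
    * sqrt (fact (nat (int l - m)) / (fact (nat (int j - k)) * fact (nat (int (l - j) - (m - k)))))"
  proof -
    have "real (int_choose (int l + m) (int j + k)) = fact (nat (int l + m)) / (fact (nat (int j + k)) * fact (nat (int (l - j) + (m - k))))"
      unfolding int_choose_def s(1)[symmetric] using assms by (auto simp: binomial_fact)
    moreover have "real (int_choose (int l - m) (int j - k)) = fact (nat (int l - m)) / (fact (nat (int j - k)) * fact (nat (int (l - j) - (m - k))))"
      unfolding int_choose_def s(2)[symmetric] using assms by (auto simp: binomial_fact)
    ultimately show ?thesis by (simp add: T_coef_def)
  qed
  have 2: "real (l choose j) = fact l / (fact j * fact (l - j))" using assms by (simp add: binomial_fact)
  have 3: "(2::real) ^ l = 2 ^ j * 2 ^ (l - j)" using assms by (simp flip: power_add)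
  show ?thesis unfolding 1 2 harm_norm_def 3
    by (simp add: real_sqrt_divide real_sqrt_mult field_simps)
qed

text \<open>After \<open>T_coef_eq\<close> the sum over k is a Cauchy product; the degree bound
  ensures that -j..j reaches all coefficients of \<open>p\<close>. A general \<open>p\<close> is
  allowed because the gradient components, rather than the harmonics, are to be inserted.\<close>

lemma sum_T_coef:
  assumes "\<bar>m\<bar> \<le> int l" "j \<le> l" "degree p \<le> 2 * j"
  shows "(\<Sum>k = - int j..int j. coeff p (nat (int j + k)) / of_real (harm_norm j k) * solid_S (l - j) (m - k) w * of_real (T_coef j k l m))
    = of_nat (l choose j) * coeff (p * null_poly w ^ (l - j)) (nat (int l + m)) / of_real (harm_norm l m)"
proof -
  define q where "q = null_poly w ^ (l - j)"
  define n where "n = nat (int l + m)"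
  define C where "C = of_nat (l choose j) / complex_of_real (harm_norm l m)"
  have q: "coeff q i = 0" if "i > 2 * (l - j)" for i
    using degree_null_poly_power[of w "l - j"] that by (auto simp: q_def intro: coeff_eq_0)
  have "(\<Sum>k = - int j..int j. coeff p (nat (int j + k)) / of_real (harm_norm j k) * solid_S (l - j) (m - k) w * of_real (T_coef j k l m))
     = (\<Sum>k = - int j..int j. C * (if nat (int j + k) \<le> n then coeff p (nat (int j + k)) * coeff q (n - nat (int j + k)) else 0))"
  proof (rule sum.cong[OF refl])
    fix k assume k: "k \<in> {- int j..int j}"
    show "coeff p (nat (int j + k)) / of_real (harm_norm j k) * solid_S (l - j) (m - k) w * of_real (T_coef j k l m)
      = C * (if nat (int j + k) \<le> n then coeff p (nat (int j + k)) * coeff q (n - nat (int j + k)) else 0)"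
    proof (cases "\<bar>m - k\<bar> \<le> int (l - j)")
      case True
      have "n - nat (int j + k) = nat (int (l - j) + (m - k))" "nat (int j + k) \<le> n"
        using True k assms by (auto simp: n_def nat_diff_distrib' of_nat_diff)
      then show ?thesis
        using k harm_norm_pos[of j k] harm_norm_pos[of "l - j" "m - k"]
          solid_S_eq[OF True, of w] T_coef_eq[OF assms(1,2) _ True]
        by (simp add: C_def q_def abs_le_iff)
    next
      \<comment> \<open>Here T vanishes, whatever the value of \<open>solid_S\<close>. On the other
        side either the guard against truncated subtraction fails or the index exceeds the degree of
        \<open>q\<close>.\<close>
      case False
      then have "T_coef j k l m = 0" using k assms by (auto simp: T_coef_def int_choose_def)
      moreover have "nat (int j + k) \<le> n \<Longrightarrow> coeff q (n - nat (int j + k)) = 0"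
        by (rule q) (use False k assms in \<open>auto simp: n_def of_nat_diff nat_diff_distrib'\<close>)
      ultimately show ?thesis by simp
    qed
  qed
  also have "\<dots> = (\<Sum>i\<le>2 * j. C * (if i \<le> n then coeff p i * coeff q (n - i) else 0))"
    by (rule sum.reindex_bij_witness[of _ "\<lambda>i. int i - int j" "\<lambda>k. nat (int j + k)"]) auto
  also have "\<dots> = C * (\<Sum>i\<le>n. coeff p i * coeff q (n - i))"
    unfolding sum_distrib_left
    by (rule sum.mono_neutral_cong) (use assms in \<open>auto intro: coeff_eq_0\<close>)
  finally show ?thesis by (simp add: coeff_mult C_def q_def n_def)
qed

subsection \<open>Curl of vector fields of the form \<open>f ((r' - r) \<times> h)\<close>\<close>

text \<open>Linearity and differentiability are carried along because \<open>ext_d\<close> is built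
  from \<open>frechet_derivative\<close>, which is meaningful only for differentiable maps; the
  theorem also asserts both.\<close>

definition has_curl :: "form1 \<Rightarrow> real^3 \<Rightarrow> complex^3 \<Rightarrow> bool" where
  "has_curl \<omega> r X \<longleftrightarrow> linear (\<omega> r) \<and> (\<forall>a. (\<lambda>s. \<omega> s a) differentiable (at r)) \<and>
     (\<forall>a b. ext_d \<omega> r a b = cdot X (nu_da a b))"

lemma nu_da_nth:
  "nu_da a b $ 1 = of_real (a$2 * b$3 - b$2 * a$3)"
  "nu_da a b $ 2 = of_real (a$3 * b$1 - b$3 * a$1)"
  "nu_da a b $ 3 = of_real (a$1 * b$2 - b$1 * a$2)"
  by (simp_all add: nu_da_def wedge_def dcoord_def)

lemma dr_nth: "dr a $ i = of_real (a $ i)"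
  using exhaust_3[of i] by (auto simp: dr_def dcoord_def)

lemma has_curl_add_scale:
  assumes "has_curl \<alpha> r X" "has_curl \<beta> r Y"
  shows "has_curl (\<lambda>s a. c * \<alpha> s a + d * \<beta> s a) r (c *s X + d *s Y)"
proof -
  have l: "linear (\<lambda>a. c * \<alpha> r a + d * \<beta> r a)"
    using assms unfolding has_curl_def linear_iff by (simp add: algebra_simps scaleR_conv_of_real[where 'a=complex])
  have D: "((\<lambda>s. c * \<alpha> s a + d * \<beta> s a) has_derivative
      (\<lambda>b. c * frechet_derivative (\<lambda>s. \<alpha> s a) (at r) b + d * frechet_derivative (\<lambda>s. \<beta> s a) (at r) b)) (at r)" for a
    using assms unfolding has_curl_def frechet_derivative_works
    by (intro has_derivative_add has_derivative_mult_right) auto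
  have "ext_d (\<lambda>s a. c * \<alpha> s a + d * \<beta> s a) r a b = c * ext_d \<alpha> r a b + d * ext_d \<beta> r a b" for a b
    unfolding ext_d_def frechet_derivative_at[OF D, symmetric] by (simp add: algebra_simps)
  then show ?thesis using assms l D unfolding has_curl_def
    by (auto simp: cdot_def sum_3 algebra_simps intro: differentiableI)
qed

text \<open>\<open>J i k\<close> is the partial derivative of the component i in the direction k, so
  this is the classical curl.\<close>

lemma has_curl_cdot_dr:
  assumes V: "\<And>i. ((\<lambda>s. V s $ i) has_derivative (\<lambda>a. \<Sum>k\<in>UNIV. J i k * of_real (a $ k))) (at r)"
  shows "has_curl (\<lambda>s a. cdot (V s) (dr a)) r
    (vector [J 3 2 - J 2 3, J 1 3 - J 3 1, J 2 1 - J 1 2])"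
proof -
  have l: "linear (\<lambda>a. cdot (V r) (dr a))"
    by (simp add: linear_iff cdot_def dr_nth sum_3 algebra_simps scaleR_conv_of_real[where 'a=complex])
  have D: "((\<lambda>s. cdot (V s) (dr a)) has_derivative
      (\<lambda>b. \<Sum>i\<in>UNIV. (\<Sum>k\<in>UNIV. J i k * of_real (b $ k)) * dr a $ i)) (at r)" for a
    unfolding cdot_def by (intro has_derivative_sum has_derivative_mult_left V)
  show ?thesis unfolding has_curl_def ext_d_def frechet_derivative_at[OF D, symmetric]
    using l D by (auto simp: cdot_def nu_da_nth dr_nth sum_3 algebra_simps intro: differentiableI)
qed

lemma has_curl_cross_field:
  fixes f :: "real^3 \<Rightarrow> complex" and h :: "real^3 \<Rightarrow> complex^3"
  assumes f: "(f has_derivative (\<lambda>a. \<Sum>k\<in>UNIV. \<phi> $ k * of_real (a $ k))) (at r)"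
    and h: "\<And>i. ((\<lambda>s. h s $ i) has_derivative (\<lambda>a. \<Sum>k\<in>UNIV. K i k * of_real (a $ k))) (at r)"
  shows "has_curl (\<lambda>s a. f s * cdot (ccross (cvec (r' - s)) (h s)) (dr a)) r
    ((f r * (\<Sum>i\<in>UNIV. K i i) + cdot \<phi> (h r)) *s cvec (r' - r)
      + (2 * f r - cdot \<phi> (cvec (r' - r))) *s h r
      - f r *s (\<chi> i. \<Sum>k\<in>UNIV. K i k * of_real ((r' - r) $ k)))"
proof -
  have c: "((\<lambda>s. cvec (r' - s) $ i) has_derivative (\<lambda>a. - of_real (a $ i))) (at r)" for i :: 3
  proof -
    have "((\<lambda>s. r' $ i - s $ i) has_derivative (\<lambda>a. 0 - a $ i)) (at r)"
      by (intro has_derivative_diff has_derivative_const bounded_linear_imp_has_derivative bounded_linear_vec_nth)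
    from bounded_linear.has_derivative[OF bounded_linear_of_real this] show ?thesis
      by (simp add: cvec_def)
  qed
  define P where "P = (\<lambda>s i j. f s * (cvec (r' - s) $ i * h s $ j))"
  define Q where "Q = (\<lambda>i j k. \<phi> $ k * (cvec (r' - r) $ i * h r $ j) 
     + f r * (cvec (r' - r) $ i * K j k - (if k = i then h r $ j else 0)))"
  have P: "((\<lambda>s. P s i j) has_derivative (\<lambda>a. \<Sum>k\<in>UNIV. Q i j k * of_real (a $ k))) (at r)" for i j
    unfolding P_def
  proof (rule has_derivative_eq_rhs[OF has_derivative_mult[OF f has_derivative_mult[OF c h]]], rule ext)
    fix a
    have "(\<Sum>k\<in>UNIV. Q i j k * of_real (a $ k)) = (\<Sum>k\<in>UNIV. \<phi> $ k * of_real (a $ k)) * (cvec (r' - r) $ i * h r $ j)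
      + f r * (cvec (r' - r) $ i * (\<Sum>k\<in>UNIV. K j k * of_real (a $ k))) - f r * (h r $ j * of_real (a $ i))"
      using exhaust_3[of i] unfolding Q_def sum_3 by (elim disjE) (simp_all add: algebra_simps)
    then show "f r * (cvec (r' - r) $ i * (\<Sum>k\<in>UNIV. K j k * of_real (a $ k)) + - of_real (a $ i) * h r $ j) +
      (\<Sum>k\<in>UNIV. \<phi> $ k * of_real (a $ k)) * (cvec (r' - r) $ i * h r $ j) = (\<Sum>k\<in>UNIV. Q i j k * of_real (a $ k))"
      by (simp only:) (simp add: algebra_simps)
  qed
  define V where "V = (\<lambda>s. vector [P s 2 3 - P s 3 2, P s 3 1 - P s 1 3, P s 1 2 - P s 2 1] :: complex^3)"
  define J where "J = (\<lambda>i::3. if i = 1 then (\<lambda>k. Q 2 3 k - Q 3 2 k) else if i = 2 then (\<lambda>k. Q 3 1 k - Q 1 3 k) else (\<lambda>k. Q 1 2 k - Q 2 1 k))"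
  have V: "((\<lambda>s. V s $ i) has_derivative (\<lambda>a. \<Sum>k\<in>UNIV. J i k * of_real (a $ k))) (at r)" for i
    using exhaust_3[of i] by (auto simp: V_def J_def left_diff_distrib sum_subtractf intro!: has_derivative_diff P)
  have "(\<lambda>s a. f s * cdot (ccross (cvec (r' - s)) (h s)) (dr a)) = (\<lambda>s a. cdot (V s) (dr a))"
    by (simp add: fun_eq_iff V_def P_def cdot_def ccross_def sum_3 algebra_simps)
  moreover have "vector [J 3 2 - J 2 3, J 1 3 - J 3 1, J 2 1 - J 1 2] = 
    ((f r * (\<Sum>i\<in>UNIV. K i i) + cdot \<phi> (h r)) *s cvec (r' - r)
      + (2 * f r - cdot \<phi> (cvec (r' - r))) *s h r
      - f r *s (\<chi> i. \<Sum>k\<in>UNIV. K i k * of_real ((r' - r) $ k)))"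
    by (simp add: vec_eq_iff forall_3 J_def Q_def cdot_def sum_3 cvec_def algebra_simps)
  ultimately show ?thesis using has_curl_cdot_dr[OF V] by simp
qed

section \<open>Derivatives of the distance, and the solid angle form\<close>

lemma has_derivative_norm_diff:
  fixes r r' :: "'a::real_inner"
  assumes "r \<noteq> r'"
  shows "((\<lambda>s. norm (r' - s)) has_derivative (\<lambda>a. - ((r' - r) \<bullet> a) / norm (r' - r))) (at r)"
proof -
  have "((\<lambda>s. r' - s) has_derivative (\<lambda>a. - a)) (at r)"
    by (auto intro!: derivative_eq_intros)
  then have "((\<lambda>s. norm (r' - s)) has_derivative (\<lambda>a. (- a) \<bullet> sgn (r' - r))) (at r)"
    using assms by (intro has_derivative_compose[OF _ has_derivative_norm]) auto
  then show ?thesis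
    by (rule has_derivative_eq_rhs) (auto simp: sgn_div_norm inner_commute divide_inverse fun_eq_iff algebra_simps)
qed

lemma has_derivative_inverse_norm_diff:
  fixes r r' :: "'a::real_inner"
  assumes "r \<noteq> r'"
  shows "((\<lambda>s. 1 / norm (r' - s)) has_derivative (\<lambda>a. ((r' - r) \<bullet> a) / norm (r' - r) ^ 3)) (at r)"
  unfolding divide_inverse mult_1_left
  by (rule has_derivative_eq_rhs[OF Deriv.has_derivative_inverse[OF _ has_derivative_norm_diff]])
    (use assms in \<open>auto simp: power3_eq_cube divide_simps fun_eq_iff\<close>)

text \<open>With p = \<open>r' - r\<close>, \<open>has_curl_cross_field\<close> is applied to h = u
  and f = -1 / (|p| (|p| + u . p)), whose gradient is \<phi>. The component along u cancels, and the
  one along p is \<phi> . u.\<close>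

lemma has_curl_omega0:
  assumes "r \<noteq> r'" "norm (r' - r) + u \<bullet> (r' - r) \<noteq> 0" "norm u = 1"
  shows "has_curl (omega0 u r') r (- of_real (1 / norm (r' - r) ^ 3) *s cvec (r' - r))"
proof -
  define p N c where "p = r' - r" and "N = norm p" and "c = u \<bullet> p"
  define \<phi> where "\<phi> = - (1 / (N * (N + c)))\<^sup>2 *\<^sub>R ((2 + c / N) *\<^sub>R p + N *\<^sub>R u)"
  have N0: "N > 0" using assms by (simp add: N_def p_def)
  have Nc: "N + c \<noteq> 0" using assms by (simp add: N_def p_def c_def)
  have pp: "p \<bullet> p = N\<^sup>2" and uu: "u \<bullet> u = 1" and pu: "p \<bullet> u = c" and up: "u \<bullet> p = c"
    using assms by (simp_all add: N_def c_def dot_square_norm inner_commute[of p u])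
  have DN: "((\<lambda>s. norm (r' - s)) has_derivative (\<lambda>a. - (p \<bullet> a) / N)) (at r)"
    unfolding N_def p_def by (rule has_derivative_norm_diff[OF assms(1)])
  have Dc: "((\<lambda>s. u \<bullet> (r' - s)) has_derivative (\<lambda>a. - (u \<bullet> a))) (at r)"
    by (auto intro!: derivative_eq_intros)
  have "((\<lambda>s. - (1 / (norm (r' - s) * (norm (r' - s) + u \<bullet> (r' - s))))) has_derivative (\<lambda>a. \<phi> \<bullet> a)) (at r)"
    unfolding divide_inverse mult_1_left
    apply (rule has_derivative_eq_rhs[OF has_derivative_minus[OF Deriv.has_derivative_inverse[OF _ has_derivative_mult[OF DN has_derivative_add[OF DN Dc]]]]])
    subgoal using N0 Nc by (simp add: N_def c_def p_def)
    subgoal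
    proof (rule ext)
      fix a
      have "(2 * N + c + c) * ((p \<bullet> a) / N) = 2 * ((p \<bullet> a)) + 2 * c * (p \<bullet> a) / N"
        using N0 by (simp add: field_simps)
      then show "- (- (inverse (norm (r' - r) * (norm (r' - r) + u \<bullet> (r' - r))) *
              (norm (r' - r) * (- (p \<bullet> a) / N + - (u \<bullet> a)) + - (p \<bullet> a) / N * (norm (r' - r) + u \<bullet> (r' - r))) *
              inverse (norm (r' - r) * (norm (r' - r) + u \<bullet> (r' - r))))) = \<phi> \<bullet> a"
        using N0 unfolding p_def[symmetric] N_def[symmetric] c_def[symmetric]
        by (simp add: \<phi>_def inner_add_left divide_inverse power2_eq_square algebra_simps)
    qed
    done
  then have f: "((\<lambda>s. complex_of_real (- (1 / (norm (r' - s) * (norm (r' - s) + u \<bullet> (r' - s)))))) has_derivative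
      (\<lambda>a. \<Sum>k\<in>UNIV. cvec \<phi> $ k * of_real (a $ k))) (at r)"
    by (rule has_derivative_eq_rhs[OF bounded_linear.has_derivative[OF bounded_linear_of_real]])
      (simp add: cvec_def inner_vec_def)
  have h: "((\<lambda>s. cvec u $ i) has_derivative (\<lambda>a. \<Sum>k\<in>UNIV. 0 * of_real (a $ k))) (at r)" for i :: 3
    by simp
  have "\<phi> \<bullet> u = - (1 / (N * (N + c)))\<^sup>2 * ((2 + c / N) * c + N)"
    by (simp add: \<phi>_def inner_add_left pp uu pu up)
  \<comment> \<open>The bracket completes to a square, which cancels the singular factor N +
    c.\<close>
  also have "\<dots> = - (1 / (N * (N + c)))\<^sup>2 * ((N + c)\<^sup>2 / N)"
    using N0 by (simp add: field_simps power2_eq_square)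
  also have "\<dots> = - 1 / N ^ 3"
    using N0 Nc by (simp add: power_mult_distrib power_divide power2_eq_square power3_eq_cube)
  finally have \<phi>u: "\<phi> \<bullet> u = - 1 / N ^ 3" .
  \<comment> \<open>Euler's relation: f is homogeneous of degree -2 in p, and p decreases with r, so
    \<phi> . p = 2 f and the coefficient of u vanishes.\<close>
  have "\<phi> \<bullet> p = - (1 / (N * (N + c)))\<^sup>2 * (2 * (N * (N + c)))"
  proof -
    have "(2 + c / N) * N\<^sup>2 + N * c = 2 * (N * (N + c))"
      using N0 by (simp add: field_simps power2_eq_square)
    then show ?thesis by (simp add: \<phi>_def inner_add_left pp up)
  qed
  also have "\<dots> = 2 * - (1 / (N * (N + c)))"
    using N0 Nc by (simp add: power2_eq_square)
  finally have \<phi>p: "\<phi> \<bullet> p = 2 * - (1 / (N * (N + c)))" .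
  have "omega0 u r' = (\<lambda>s a. complex_of_real (- (1 / (norm (r' - s) * (norm (r' - s) + u \<bullet> (r' - s))))) * cdot (ccross (cvec (r' - s)) (cvec u)) (dr a))"
    by (simp add: omega0_def fun_eq_iff)
  moreover have "cdot (cvec \<phi>) (cvec u) = of_real (- 1 / N ^ 3)"
    "cdot (cvec \<phi>) (cvec p) = of_real (2 * - (1 / (N * (N + c))))"
    by (simp_all only: cdot_cvec \<phi>u \<phi>p)
  ultimately show ?thesis
    using has_curl_cross_field[OF f h, of r'] unfolding p_def[symmetric] N_def[symmetric] c_def[symmetric]
    by (simp flip: zero_vec_def)
qed

subsection \<open>The vector potential\<close>

text \<open>Differentiating coefficientwise keeps the calculus at the level of polynomials, so that
  a coefficient is extracted only at the end.\<close>

definition has_coeff_derivative :: "(real^3 \<Rightarrow> complex poly) \<Rightarrow> (real^3 \<Rightarrow> complex poly) \<Rightarrow> real^3 \<Rightarrow> bool" where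
  "has_coeff_derivative f f' r \<longleftrightarrow> (\<forall>n. ((\<lambda>s. coeff (f s) n) has_derivative (\<lambda>a. coeff (f' a) n)) (at r))"

lemma has_coeff_derivative_const: "has_coeff_derivative (\<lambda>_. p) (\<lambda>_. 0) r"
  by (simp add: has_coeff_derivative_def)

lemma has_coeff_derivative_null_poly: "has_coeff_derivative null_poly null_poly r"
proof -
  have "linear (\<lambda>s. coeff (null_poly s) n)" for n
    by (auto simp: linear_iff null_poly_def coeff_pCons complex_eq_iff algebra_simps split: nat.splits)
  then show ?thesis
    unfolding has_coeff_derivative_def
    by (auto intro!: bounded_linear_imp_has_derivative simp: linear_conv_bounded_linear)
qed

lemma has_coeff_derivative_mult:
  assumes "has_coeff_derivative f f' r" "has_coeff_derivative g g' r"
  shows "has_coeff_derivative (\<lambda>s. f s * g s) (\<lambda>a. f r * g' a + f' a * g r) r"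
  unfolding has_coeff_derivative_def coeff_mult coeff_add sum.distrib[symmetric]
  using assms by (auto intro!: has_derivative_sum has_derivative_mult simp: has_coeff_derivative_def)

lemma has_coeff_derivative_power:
  "has_coeff_derivative (\<lambda>s. null_poly s ^ n) (\<lambda>a. of_nat n * null_poly r ^ (n - 1) * null_poly a) r"
proof (induction n)
  case (Suc n)
  have "(\<lambda>a. null_poly r * (of_nat n * null_poly r ^ (n - 1) * null_poly a) + null_poly a * null_poly r ^ n) =
    (\<lambda>a. of_nat (Suc n) * null_poly r ^ (Suc n - 1) * null_poly a)"
    by (cases n) (auto simp: fun_eq_iff algebra_simps)
  then show ?case
    using has_coeff_derivative_mult[OF has_coeff_derivative_null_poly Suc] by simp
qed (simp add: has_coeff_derivative_def)

text \<open>By linearity these are the partial derivatives of \<open>null_poly\<close>.\<close>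

abbreviation null_basis :: "3 \<Rightarrow> complex poly" where
  "null_basis i \<equiv> null_poly (axis i 1)"

lemma null_poly_sum: "null_poly a = (\<Sum>k\<in>UNIV. smult (of_real (a $ k)) (null_basis k))"
  by (simp add: sum_3 null_poly_def axis_def complex_eq_iff)

text \<open>The three polynomials are 2 s, s^2 - 1 and i (s^2 + 1). This null vector is the source
  of harmonicity.\<close>

lemma null_basis_squares: "(\<Sum>i\<in>UNIV. null_basis i * null_basis i) = 0"
  by (simp add: sum_3 null_poly_def axis_def complex_eq_iff)

lemma null_poly_diff: "null_poly (a - b) = null_poly a - null_poly b"
  by (simp add: null_poly_def complex_eq_iff)

lemma coeff_mult_null_poly:
  "coeff (p * null_poly a) n = (\<Sum>k\<in>UNIV. coeff (p * null_basis k) n * of_real (a $ k))"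
  by (simp add: null_poly_sum[of a] sum_distrib_left coeff_sum mult_ac)

lemma has_derivative_solid_S:
  assumes "\<bar>m\<bar> \<le> int l"
  shows "(solid_S l m has_derivative
    (\<lambda>a. coeff (of_nat l * null_poly r ^ (l - 1) * null_poly a) (nat (int l + m)) / of_real (harm_norm l m))) (at r)"
  unfolding solid_S_eq[OF assms, abs_def]
  using has_coeff_derivative_power[of l r]
  by (auto simp: has_coeff_derivative_def divide_inverse intro!: has_derivative_mult_left)

lemma cgrad_solid_S:
  assumes "\<bar>m\<bar> \<le> int l"
  shows "cgrad (solid_S l m) r $ i =
    coeff (of_nat l * null_poly r ^ (l - 1) * null_basis i) (nat (int l + m)) / of_real (harm_norm l m)"
  by (simp add: cgrad_def flip: frechet_derivative_at[OF has_derivative_solid_S[OF assms]])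

text \<open>The divided difference (x^l - y^l) / (x - y), written without division so that it makes
  sense for polynomials.\<close>

definition hom_sum :: "nat \<Rightarrow> 'a \<Rightarrow> 'a \<Rightarrow> 'a::comm_ring_1" where
  "hom_sum l x y = (\<Sum>j = 1..l. x ^ (j - 1) * y ^ (l - j))"

text \<open>The derivative of \<open>hom_sum\<close> with respect to \<open>x\<close>.\<close>
definition hom_sum' :: "nat \<Rightarrow> 'a \<Rightarrow> 'a \<Rightarrow> 'a::comm_ring_1" where
  "hom_sum' l x y = (\<Sum>j = 1..l. of_nat (j - 1) * x ^ (j - 1 - 1) * y ^ (l - j))"

lemma hom_sum_Suc: "hom_sum (Suc l) x y = y * hom_sum l x y + x ^ l"
  by (auto simp: hom_sum_def sum_distrib_left Suc_diff_le mult_ac intro!: sum.cong)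

lemma hom_sum'_Suc: "hom_sum' (Suc l) x y = y * hom_sum' l x y + of_nat l * x ^ (l - 1)"
  by (auto simp: hom_sum'_def sum_distrib_left Suc_diff_le mult_ac intro!: sum.cong)

lemma hom_sum_telescope: "(x - y) * hom_sum l x y = x ^ l - y ^ l"
proof (induction l)
  case (Suc l)
  have "(x - y) * hom_sum (Suc l) x y = y * ((x - y) * hom_sum l x y) + (x - y) * x ^ l"
    by (simp add: hom_sum_Suc algebra_simps)
  also have "\<dots> = x ^ Suc l - y ^ Suc l"
    unfolding Suc.IH by (simp add: algebra_simps)
  finally show ?case .
qed (simp add: hom_sum_def)

text \<open>The derivative of \<open>hom_sum_telescope\<close> with respect to x.\<close>

lemma hom_sum_telescope': "hom_sum l x y + (x - y) * hom_sum' l x y = of_nat l * x ^ (l - 1)"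
proof (induction l)
  case (Suc l)
  have "hom_sum (Suc l) x y + (x - y) * hom_sum' (Suc l) x y =
      y * (hom_sum l x y + (x - y) * hom_sum' l x y) + x ^ l + (x - y) * (of_nat l * x ^ (l - 1))"
    by (simp add: hom_sum_Suc hom_sum'_Suc algebra_simps)
  also have "\<dots> = x ^ l + of_nat l * (x * x ^ (l - 1))"
    unfolding Suc.IH by (simp add: algebra_simps)
  also have "of_nat l * (x * x ^ (l - 1)) = of_nat l * x ^ l"
    by (cases l) auto
  finally show ?case by (simp add: algebra_simps)
qed (simp add: hom_sum_def hom_sum'_def)

lemma has_coeff_derivative_hom_sum:
  "has_coeff_derivative (\<lambda>s. hom_sum l (null_poly s) q) (\<lambda>a. hom_sum' l (null_poly r) q * null_poly a) r"
proof -
  have "has_coeff_derivative (\<lambda>s. null_poly s ^ (j - 1) * q ^ (l - j))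
    (\<lambda>a. of_nat (j - 1) * null_poly r ^ (j - 1 - 1) * q ^ (l - j) * null_poly a) r" for j
    using has_coeff_derivative_mult[OF has_coeff_derivative_power[of "j - 1" r] has_coeff_derivative_const[of "q ^ (l - j)"]]
    by (simp add: mult_ac)
  then show ?thesis
    unfolding has_coeff_derivative_def hom_sum_def hom_sum'_def coeff_sum sum_distrib_right
    by (intro allI has_derivative_sum) blast
qed

text \<open>The field H: the summand j is the gradient of the coefficient of (L r)^j (L r')^(l-j)
  divided by j.\<close>

definition pot_grad :: "nat \<Rightarrow> int \<Rightarrow> real^3 \<Rightarrow> real^3 \<Rightarrow> complex^3" where
  "pot_grad l m r' r = (\<chi> i. coeff (hom_sum l (null_poly r) (null_poly r') * null_basis i) (nat (int l + m))
     / of_real (harm_norm l m))"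

definition pot_hess :: "nat \<Rightarrow> int \<Rightarrow> real^3 \<Rightarrow> real^3 \<Rightarrow> 3 \<Rightarrow> 3 \<Rightarrow> complex" where
  "pot_hess l m r' r i k = coeff (hom_sum' l (null_poly r) (null_poly r') * null_basis i * null_basis k) (nat (int l + m))
     / of_real (harm_norm l m)"

lemma has_derivative_pot_grad:
  "((\<lambda>s. pot_grad l m r' s $ i) has_derivative (\<lambda>a. \<Sum>k\<in>UNIV. pot_hess l m r' r i k * of_real (a $ k))) (at r)"
proof -
  let ?W = "\<lambda>a. hom_sum' l (null_poly r) (null_poly r') * null_basis i * null_poly a"
  have "has_coeff_derivative (\<lambda>s. hom_sum l (null_poly s) (null_poly r') * null_basis i) ?W r"
    using has_coeff_derivative_mult[OF has_coeff_derivative_hom_sum[of l "null_poly r'" r] has_coeff_derivative_const[of "null_basis i"]]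
    by (simp add: mult_ac)
  then have "((\<lambda>s. pot_grad l m r' s $ i) has_derivative
      (\<lambda>a. coeff (?W a) (nat (int l + m)) / of_real (harm_norm l m))) (at r)"
    by (auto simp: has_coeff_derivative_def pot_grad_def divide_inverse intro!: has_derivative_mult_left)
  moreover have "coeff (?W a) (nat (int l + m)) / of_real (harm_norm l m) =
      (\<Sum>k\<in>UNIV. pot_hess l m r' r i k * of_real (a $ k))" for a
    by (simp add: coeff_mult_null_poly[of _ a] pot_hess_def sum_divide_distrib)
  ultimately show ?thesis by simp
qed

lemma pot_hess_trace: "(\<Sum>i\<in>UNIV. pot_hess l m r' r i i) = 0"
proof -
  have "(\<Sum>i\<in>UNIV. pot_hess l m r' r i i) =
    coeff (hom_sum' l (null_poly r) (null_poly r') * (\<Sum>i\<in>UNIV. null_basis i * null_basis i)) (nat (int l + m)) / of_real (harm_norm l m)"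
    by (simp add: pot_hess_def sum_distrib_left coeff_sum sum_divide_distrib mult.assoc)
  then show ?thesis by (simp add: null_basis_squares)
qed

lemma pot_grad_radial:
  assumes "\<bar>m\<bar> \<le> int l"
  shows "cdot (pot_grad l m r' r) (cvec (r - r')) = solid_S l m r - solid_S l m r'"
proof -
  have "cdot (pot_grad l m r' r) (cvec (r - r')) =
    coeff (hom_sum l (null_poly r) (null_poly r') * null_poly (r - r')) (nat (int l + m)) / of_real (harm_norm l m)"
    by (simp add: coeff_mult_null_poly[of _ "r - r'"] cdot_def pot_grad_def cvec_def sum_divide_distrib)
  then show ?thesis
    by (simp add: null_poly_diff mult.commute[of "hom_sum _ _ _"] hom_sum_telescope solid_S_eq[OF assms] diff_divide_distrib)
qed

text \<open>Contraction with \<open>r - r'\<close> multiplies by L r - L r', and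
  \<open>hom_sum_telescope'\<close> leaves l (L r)^(l-1), which belongs to the gradient of
  S.\<close>

lemma pot_hess_radial:
  assumes "\<bar>m\<bar> \<le> int l"
  shows "pot_grad l m r' r $ i + (\<Sum>k\<in>UNIV. pot_hess l m r' r i k * of_real ((r - r') $ k)) = cgrad (solid_S l m) r $ i"
proof -
  let ?W = "hom_sum l (null_poly r) (null_poly r')" and ?W' = "hom_sum' l (null_poly r) (null_poly r')"
  have "pot_grad l m r' r $ i + (\<Sum>k\<in>UNIV. pot_hess l m r' r i k * of_real ((r - r') $ k)) =
    coeff (?W * null_basis i + ?W' * null_basis i * null_poly (r - r')) (nat (int l + m)) / of_real (harm_norm l m)"
    by (simp only: coeff_mult_null_poly[of _ "r - r'"] pot_grad_def pot_hess_def coeff_add add_divide_distrib sum_divide_distrib vec_lambda_beta times_divide_eq_left)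
  also have "?W * null_basis i + ?W' * null_basis i * null_poly (r - r') =
      (?W + (null_poly r - null_poly r') * ?W') * null_basis i"
    by (simp add: null_poly_diff algebra_simps)
  finally show ?thesis by (simp only: hom_sum_telescope' cgrad_solid_S[OF assms])
qed

section \<open>Reduction of the form \<psi> to the potential\<close>

lemma cdot_ccross: "cdot (ccross c h) d = (\<Sum>i\<in>UNIV. ccross d c $ i * h $ i)"
  by (simp add: cdot_def ccross_def sum_3 algebra_simps)

text \<open>For each j the addition theorem is applied to the components of the gradient of (L r)^j,
  and the weight \<open>D_coef j l\<close> removes the numerical factor that results.\<close>

lemma psi_form_eq:
  assumes "\<bar>m\<bar> \<le> int l"
  shows "psi_form l m r' r a = of_real (1 / (4 * pi)) *
    (of_real (1 / norm (r' - r)) * cdot (ccross (cvec (r' - r)) (pot_grad l m r' r)) (dr a))"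
proof -
  \<comment> \<open>By the cyclic symmetry of the triple product, \<gamma> isolates the gradient, so
    that the sums over j and k act on its components alone.\<close>
  define \<gamma> where "\<gamma> = ccross (dr a) (cvec (r' - r))"
  define c where "c = complex_of_real (harm_norm l m)"
  define n where "n = nat (int l + m)"
  have "of_real (D_coef j l) * (\<Sum>k = - int j..int j. v_form j k r' r a * solid_S (l - j) (m - k) r' * of_real (T_coef j k l m)) =
     of_real (1 / norm (r' - r)) * (\<Sum>i\<in>UNIV. \<gamma> $ i * (coeff (null_poly r ^ (j - 1) * null_poly r' ^ (l - j) * null_basis i) n / c))"
    if j: "j \<in> {1..l}" for j
  proof -
    let ?p = "\<lambda>i. of_nat j * null_poly r ^ (j - 1) * null_basis i"
    have deg: "degree (?p i) \<le> 2 * j" for i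
    proof -
      have "degree (?p i) \<le> 2 * (j - 1) + 2 * 1"
        using degree_null_poly_power[of r "j - 1"] degree_null_poly_power[of "axis i 1" 1]
        by (intro order.trans[OF degree_mult_le] add_mono) (auto simp: of_nat_poly intro: order.trans[OF degree_mult_le] order.trans[OF degree_smult_le])
      also have "2 * (j - 1) + 2 * 1 = 2 * j" using j by auto
      finally show ?thesis .
    qed
    have "(\<Sum>k = - int j..int j. v_form j k r' r a * solid_S (l - j) (m - k) r' * of_real (T_coef j k l m)) =
      (\<Sum>k = - int j..int j. of_real (1 / norm (r' - r)) * (\<Sum>i\<in>UNIV. \<gamma> $ i *
        (coeff (?p i) (nat (int j + k)) / of_real (harm_norm j k) * solid_S (l - j) (m - k) r' * of_real (T_coef j k l m))))"
      by (rule sum.cong) (auto simp: v_form_def cdot_ccross \<gamma>_def cgrad_solid_S abs_le_iff sum_distrib_left sum_distrib_right intro!: sum.cong)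
    also have "\<dots> = of_real (1 / norm (r' - r)) * (\<Sum>i\<in>UNIV. \<gamma> $ i *
        (\<Sum>k = - int j..int j. coeff (?p i) (nat (int j + k)) / of_real (harm_norm j k) * solid_S (l - j) (m - k) r' * of_real (T_coef j k l m)))"
      unfolding sum_distrib_left by (rule sum.swap)
    also have "\<dots> = of_real (1 / norm (r' - r)) * (\<Sum>i\<in>UNIV. \<gamma> $ i *
        (of_nat (l choose j) * coeff (?p i * null_poly r' ^ (l - j)) n / c))"
      using j deg by (subst sum_T_coef[OF assms]) (auto simp: n_def c_def)
    also have "\<dots> = of_real (1 / norm (r' - r)) * (\<Sum>i\<in>UNIV. \<gamma> $ i *
        (of_nat (j * (l choose j)) * (coeff (null_poly r ^ (j - 1) * null_poly r' ^ (l - j) * null_basis i) n / c)))"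
    proof -
      have "coeff (?p i * null_poly r' ^ (l - j)) n = of_nat j * coeff (null_poly r ^ (j - 1) * null_poly r' ^ (l - j) * null_basis i) n" for i
        by (simp add: of_nat_poly mult_ac)
      then show ?thesis by (simp only:) (simp add: mult_ac)
    qed
    finally have *: "(\<Sum>k = - int j..int j. v_form j k r' r a * solid_S (l - j) (m - k) r' * of_real (T_coef j k l m)) =
      of_nat (j * (l choose j)) * (of_real (1 / norm (r' - r)) * (\<Sum>i\<in>UNIV. \<gamma> $ i *
        (coeff (null_poly r ^ (j - 1) * null_poly r' ^ (l - j) * null_basis i) n / c)))"
      by (simp add: sum_distrib_left mult_ac)
    \<comment> \<open>The factor j stems from differentiating the power j, and the binomial from the
      addition theorem.\<close>
    have "D_coef j l * real (j * (l choose j)) = 1"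
    proof -
      have "fact j = real j * fact (j - 1)" using j by (simp add: fact_reduce)
      then show ?thesis using j by (simp add: D_coef_eq binomial_fact)
    qed
    then have D: "complex_of_real (D_coef j l) * of_nat (j * (l choose j)) = 1"
      by (metis of_real_1 of_real_mult of_real_of_nat_eq)
    show ?thesis unfolding * mult.assoc[symmetric] D by simp
  qed
  then have "psi_form l m r' r a = of_real (1 / (4 * pi)) * (\<Sum>j = 1..l. of_real (1 / norm (r' - r)) *
      (\<Sum>i\<in>UNIV. \<gamma> $ i * (coeff (null_poly r ^ (j - 1) * null_poly r' ^ (l - j) * null_basis i) n / c)))"
    by (simp add: psi_form_def)
  also have "(\<Sum>j = 1..l. of_real (1 / norm (r' - r)) *
      (\<Sum>i\<in>UNIV. \<gamma> $ i * (coeff (null_poly r ^ (j - 1) * null_poly r' ^ (l - j) * null_basis i) n / c))) =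
    of_real (1 / norm (r' - r)) * (\<Sum>i\<in>UNIV. \<gamma> $ i * (\<Sum>j = 1..l. coeff (null_poly r ^ (j - 1) * null_poly r' ^ (l - j) * null_basis i) n / c))"
    unfolding sum_distrib_left by (rule sum.swap)
  also have "(\<Sum>i\<in>UNIV. \<gamma> $ i * (\<Sum>j = 1..l. coeff (null_poly r ^ (j - 1) * null_poly r' ^ (l - j) * null_basis i) n / c)) =
    cdot (ccross (cvec (r' - r)) (pot_grad l m r' r)) (dr a)"
    by (simp add: cdot_ccross \<gamma>_def pot_grad_def hom_sum_def sum_distrib_right coeff_sum sum_divide_distrib n_def c_def)
  finally show ?thesis .
qed

section \<open>The kernel, the curl of \<psi> and the final assembly\<close>

lemma has_derivative_complex_inverse_norm:
  fixes r r' :: "real^3"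
  assumes "r \<noteq> r'"
  shows "((\<lambda>s. complex_of_real (1 / norm (r' - s))) has_derivative
    (\<lambda>a. \<Sum>k\<in>UNIV. (of_real (1 / norm (r' - r) ^ 3) *s cvec (r' - r)) $ k * of_real (a $ k))) (at r)"
  by (rule has_derivative_eq_rhs[OF bounded_linear.has_derivative[OF bounded_linear_of_real
        has_derivative_inverse_norm_diff[OF assms]]])
    (simp add: inner_vec_def cvec_def fun_eq_iff sum_divide_distrib)

lemma cgrad_green:
  assumes "r \<noteq> r'"
  shows "cgrad (\<lambda>s. complex_of_real (green r' s)) r = of_real (1 / (4 * pi) * (1 / norm (r' - r) ^ 3)) *s cvec (r' - r)"
proof -
  have "((\<lambda>s. complex_of_real (1 / (4 * pi)) * complex_of_real (1 / norm (r' - s))) has_derivative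
     (\<lambda>a. complex_of_real (1 / (4 * pi)) * (\<Sum>k\<in>UNIV. (of_real (1 / norm (r' - r) ^ 3) *s cvec (r' - r)) $ k * of_real (a $ k)))) (at r)"
    by (intro has_derivative_mult_right has_derivative_complex_inverse_norm assms)
  moreover have "(\<lambda>s. complex_of_real (1 / (4 * pi)) * complex_of_real (1 / norm (r' - s))) = (\<lambda>s. complex_of_real (green r' s))"
    by (simp add: green_def fun_eq_iff)
  ultimately have G: "((\<lambda>s. complex_of_real (green r' s)) has_derivative
     (\<lambda>a. complex_of_real (1 / (4 * pi)) * (\<Sum>k\<in>UNIV. (of_real (1 / norm (r' - r) ^ 3) *s cvec (r' - r)) $ k * of_real (a $ k)))) (at r)"
    by (simp only:)
  have ax: "(\<Sum>k\<in>UNIV. f k * complex_of_real (axis i 1 $ k)) = f i" for f and i :: 3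
    by (simp add: axis_def if_distrib[of of_real] if_distrib[of "\<lambda>x. _ * x"] cong: if_cong)
  show ?thesis
    unfolding cgrad_def frechet_derivative_at[OF G, symmetric] ax by (simp add: vec_eq_iff)
qed

text \<open>Here f = 1/|p| with p = \<open>r' - r\<close> and gradient \<phi> = p / |p|^3. As div H
  = 0 and 2 f - \<phi> . p = f, what remains besides the multiple \<phi> . H of p is f (H - (p .
  grad) H), and the bracket is the gradient of S.\<close>

lemma has_curl_psi:
  assumes "r \<noteq> r'" "\<bar>m\<bar> \<le> int l"
  shows "has_curl (\<lambda>s a. of_real (1 / norm (r' - s)) * cdot (ccross (cvec (r' - s)) (pot_grad l m r' s)) (dr a)) r
    (of_real (1 / norm (r' - r)) *s cgrad (solid_S l m) r
      - (of_real (1 / norm (r' - r) ^ 3) * (solid_S l m r - solid_S l m r')) *s cvec (r' - r))"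
proof -
  define p N where "p = r' - r" and "N = norm p"
  define H K where "H = pot_grad l m r' r" and "K = pot_hess l m r' r"
  have N: "N > 0" using assms by (simp add: N_def p_def)
  have \<phi>p: "cdot (of_real (1 / N ^ 3) *s cvec p) (cvec p) = of_real (1 / N)"
  proof -
    have "cdot (of_real (1 / N ^ 3) *s cvec p) (cvec p) = of_real (1 / N ^ 3) * cdot (cvec p) (cvec p)"
      by (simp add: cdot_def sum_distrib_left mult_ac)
    also have "\<dots> = of_real (1 / N ^ 3 * (p \<bullet> p))" by (simp only: cdot_cvec of_real_mult)
    also have "1 / N ^ 3 * (p \<bullet> p) = 1 / N"
      using N by (simp add: N_def dot_square_norm power2_eq_square power3_eq_cube)
    finally show ?thesis .
  qed
  have \<phi>H: "cdot (of_real (1 / N ^ 3) *s cvec p) H = - (of_real (1 / N ^ 3) * (solid_S l m r - solid_S l m r'))"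
  proof -
    have "cdot (of_real (1 / N ^ 3) *s cvec p) H = - (of_real (1 / N ^ 3) * cdot H (cvec (r - r')))"
      by (simp add: cdot_def sum_distrib_left sum_negf[symmetric] p_def cvec_def algebra_simps)
    then show ?thesis by (simp only: pot_grad_radial[OF assms(2)] H_def)
  qed
  have KH: "of_real (1 / N) *s H - of_real (1 / N) *s (\<chi> i. \<Sum>k\<in>UNIV. K i k * of_real (p $ k)) = of_real (1 / N) *s cgrad (solid_S l m) r"
  proof -
    have "H - (\<chi> i. \<Sum>k\<in>UNIV. K i k * of_real (p $ k)) = cgrad (solid_S l m) r"
    proof -
      have "(\<Sum>k\<in>UNIV. K i k * of_real ((r - r') $ k)) = - (\<Sum>k\<in>UNIV. K i k * of_real (p $ k))" for i
        by (simp add: p_def algebra_simps flip: sum_negf)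
      then show ?thesis
        using pot_hess_radial[OF assms(2), of r' r] by (simp add: vec_eq_iff H_def K_def)
    qed
    then show ?thesis unfolding vector_ssub_ldistrib[symmetric] by simp
  qed
  \<comment> \<open>The left side copies the shape produced by \<open>has_curl_cross_field\<close>,
    with 0 for the divergence, so that the last rewriting is syntactic.\<close>
  have "(of_real (1 / N) * 0 + cdot (of_real (1 / N ^ 3) *s cvec p) H) *s cvec p
      + (2 * of_real (1 / N) - cdot (of_real (1 / N ^ 3) *s cvec p) (cvec p)) *s H
      - of_real (1 / N) *s (\<chi> i. \<Sum>k\<in>UNIV. K i k * of_real (p $ k)) =
    (- (of_real (1 / N ^ 3) * (solid_S l m r - solid_S l m r'))) *s cvec p
      + (of_real (1 / N) *s H - of_real (1 / N) *s (\<chi> i. \<Sum>k\<in>UNIV. K i k * of_real (p $ k)))"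
    unfolding \<phi>p \<phi>H by simp
  also have "\<dots> = of_real (1 / N) *s cgrad (solid_S l m) r - (of_real (1 / N ^ 3) * (solid_S l m r - solid_S l m r')) *s cvec p"
    unfolding KH by (simp add: vec_eq_iff)
  finally have "(of_real (1 / N) * 0 + cdot (of_real (1 / N ^ 3) *s cvec p) H) *s cvec p
      + (2 * of_real (1 / N) - cdot (of_real (1 / N ^ 3) *s cvec p) (cvec p)) *s H
      - of_real (1 / N) *s (\<chi> i. \<Sum>k\<in>UNIV. K i k * of_real (p $ k)) =
    of_real (1 / N) *s cgrad (solid_S l m) r - (of_real (1 / N ^ 3) * (solid_S l m r - solid_S l m r')) *s cvec p" .
  moreover have "(\<Sum>i\<in>UNIV. K i i) = 0" by (simp only: K_def pot_hess_trace)
  ultimately show ?thesis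
    using has_curl_cross_field[OF has_derivative_complex_inverse_norm[OF assms(1)] has_derivative_pot_grad[of l m r'], of r']
    unfolding p_def[symmetric] N_def[symmetric] H_def[symmetric] K_def[symmetric] by (simp only:)
qed

theorem theorem3p17:
  fixes M P :: "(real^3) set" and n :: "real^3 \<Rightarrow> real^3"
    and r' u :: "real^3" and l :: nat and m :: int
  assumes "smooth_oriented_surface M n"
    and "triangular_patch M n P"
    and "r' \<notin> P"
    and "1 \<le> m" and "m \<le> int l"
    and "norm u = 1"
    and "\<forall>r\<in>P. (r' - r) \<bullet> u \<ge> 0"
  shows "\<exists>N. open N \<and> P \<subseteq> N \<and>
    (\<forall>r\<in>N. r \<noteq> r' \<and> norm (r' - r) + u \<bullet> (r' - r) \<noteq> 0) \<and>
    differentiable_form1_on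
      (\<lambda>r a. psi_form l m r' r a + complex_of_real (1 / (4 * pi)) * solid_S l m r' * omega0 u r' r a) N \<and>
    (\<forall>r\<in>N. \<forall>a b. ext_d
      (\<lambda>r a. psi_form l m r' r a + complex_of_real (1 / (4 * pi)) * solid_S l m r' * omega0 u r' r a) r a b
      = chi_form l m r' r a b)"
proof -
  let ?\<omega> = "\<lambda>r a. psi_form l m r' r a + complex_of_real (1 / (4 * pi)) * solid_S l m r' * omega0 u r' r a"
  \<comment> \<open>The complement of the ray from \<open>r'\<close> in the direction u. Its
    endpoint is included in the ray, so this also excludes r = \<open>r'\<close>.\<close>
  define N where "N = {r. norm (r' - r) + u \<bullet> (r' - r) \<noteq> 0}"
  have lm: "\<bar>m\<bar> \<le> int l" using assms by simp
  have "open N" unfolding N_def by (intro open_Collect_neq continuous_intros)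
  moreover have "P \<subseteq> N"
  proof
    fix r assume "r \<in> P"
    then have "norm (r' - r) > 0" "u \<bullet> (r' - r) \<ge> 0"
      using assms(3,7) by (auto simp: inner_commute)
    then have "norm (r' - r) + u \<bullet> (r' - r) > 0" by linarith
    then show "r \<in> N" by (simp add: N_def)
  qed
  moreover have ne: "\<forall>r\<in>N. r \<noteq> r' \<and> norm (r' - r) + u \<bullet> (r' - r) \<noteq> 0"
    by (auto simp: N_def)
  moreover have "has_curl ?\<omega> r (complex_of_real (green r' r) *s cgrad (solid_S l m) r
           - solid_S l m r *s cgrad (\<lambda>s. complex_of_real (green r' s)) r)" if "r \<in> N" for r
  proof -
    have r: "r \<noteq> r'" "norm (r' - r) + u \<bullet> (r' - r) \<noteq> 0" using ne that by auto
    let ?c = "complex_of_real (1 / (4 * pi))"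
    have "complex_of_real (green r' r) = ?c * of_real (1 / norm (r' - r))"
      by (simp add: green_def)
    moreover have "(c * q) *s X - S *s ((c * t) *s Y) = c *s (q *s X - (t * (S - S')) *s Y) + (c * S') *s (- t *s Y)"
      for c q t S S' :: complex and X Y :: "complex^3"
      by (simp add: vec_eq_iff algebra_simps)
    ultimately have "complex_of_real (green r' r) *s cgrad (solid_S l m) r
           - solid_S l m r *s cgrad (\<lambda>s. complex_of_real (green r' s)) r =
       ?c *s (of_real (1 / norm (r' - r)) *s cgrad (solid_S l m) r
        - (of_real (1 / norm (r' - r) ^ 3) * (solid_S l m r - solid_S l m r')) *s cvec (r' - r))
       + (?c * solid_S l m r') *s (- of_real (1 / norm (r' - r) ^ 3) *s cvec (r' - r))"
      by (simp only: cgrad_green[OF r(1)] of_real_mult)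
    then show ?thesis
      using has_curl_add_scale[OF has_curl_psi[OF r(1) lm] has_curl_omega0[OF r assms(6)], of ?c "?c * solid_S l m r'"]
      by (simp only: psi_form_eq[OF lm])
  qed
  ultimately show ?thesis
    by (intro exI[of _ N]) (simp add: has_curl_def differentiable_form1_on_def chi_form_def)
qed

end
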